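(* Let $\Omega \subset \mathbb{R}^n$ be a bounded domain with smooth boundary, and let $f:[0,\infty)\to[0,\infty)$ be a $C^2$ function with $f>0$, $f'\geq 0$ and $f''\leq 0$ on $[0,\infty)$ and $$ f'(0) \leq \frac{2n\,\omega_n^{2/n}}{|\Omega|^{2/n}}, $$ where $\omega_n$ is the volume of the unit ball in $\mathbb{R}^n$. Let $u:\overline{\Omega}\to[0,\infty)$, $u\in C^2(\overline{\Omega})$, be a solution of $$ -\Delta u = f(u)\ \text{ in } \Omega, \qquad u = 0 \ \text{ on } \partial\Omega. $$ If the Hessian $D^2u(x)$ is negative semi-definite for all $x\in\partial\Omega$, then $u$ is concave in $\Omega$.
   Context: A domain is a nonempty connected open set, and $|\Omega|$ denotes the Lebesgue measure of $\Omega$. $D^2u$ denotes the Hessian matrix of $u$; at boundary points it is understood as the continuous extension of $D^2u$ from $\Omega$ to $\overline{\Omega}$. Concavity of $u$ in $\Omega$ means $\frac{\partial^2 u}{\partial \nu^2}(x)\le 0$ for all $x\in\Omega$ and all unit vectors $\nu$, i.e. $D^2u(x)$ is negative semi-definite for every $x \in \Omega$. *)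

theory Defs
  imports "HOL-Analysis.Analysis"
begin

definition dir_deriv :: "real ^ 'n \<Rightarrow> (real ^ 'n \<Rightarrow> real) \<Rightarrow> real ^ 'n \<Rightarrow> real" where
  "dir_deriv v g x = frechet_derivative g (at x) v"

definition partial_deriv :: "'n \<Rightarrow> (real ^ 'n \<Rightarrow> real) \<Rightarrow> real ^ 'n \<Rightarrow> real" where
  "partial_deriv i g = dir_deriv (axis i 1) g"

definition hessian :: "(real ^ 'n \<Rightarrow> real) \<Rightarrow> real ^ 'n \<Rightarrow> real ^ 'n ^ 'n" where
  "hessian g x = (\<chi> i j. partial_deriv i (partial_deriv j g) x)"

definition laplacian :: "(real ^ 'n \<Rightarrow> real) \<Rightarrow> real ^ 'n \<Rightarrow> real" where
  "laplacian g x = (\<Sum>i\<in>UNIV. partial_deriv i (partial_deriv i g) x)"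

definition neg_semidefinite :: "real ^ 'n ^ 'n \<Rightarrow> bool" where
  "neg_semidefinite A \<longleftrightarrow> (\<forall>v. v \<bullet> (A *v v) \<le> 0)"

(* Only used for open S, where the two-sided derivatives are the right ones. *)
primrec Ck_on :: "nat \<Rightarrow> (real ^ 'n) set \<Rightarrow> (real ^ 'n \<Rightarrow> real) \<Rightarrow> bool" where
  "Ck_on 0 S g \<longleftrightarrow> continuous_on S g"
| "Ck_on (Suc k) S g \<longleftrightarrow>
     (\<forall>x\<in>S. g differentiable (at x)) \<and> (\<forall>v. Ck_on k S (dir_deriv v g))"

definition smooth_on :: "(real ^ 'n) set \<Rightarrow> (real ^ 'n \<Rightarrow> real) \<Rightarrow> bool" where
  "smooth_on S g \<longleftrightarrow> (\<forall>k. Ck_on k S g)"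

(* Near each boundary point, \<Omega> is the region above the graph of a smooth function of the
   n - 1 coordinates orthogonal to some unit vector e. A function on the hyperplane orthogonal
   to e is represented by a function \<gamma> on the whole space, evaluated only on that hyperplane. *)
definition smooth_boundary :: "(real ^ 'n) set \<Rightarrow> bool" where
  "smooth_boundary \<Omega> \<longleftrightarrow>
     (\<forall>p\<in>frontier \<Omega>. \<exists>r>0. \<exists>e \<gamma>. norm e = 1 \<and> smooth_on UNIV \<gamma> \<and>
        \<Omega> \<inter> ball p r = {x \<in> ball p r. x \<bullet> e > \<gamma> (x - (x \<bullet> e) *\<^sub>R e)})"

definition extends_to_closure :: "(real ^ 'n) set \<Rightarrow> (real ^ 'n \<Rightarrow> real) \<Rightarrow> bool" where
  "extends_to_closure \<Omega> g \<longleftrightarrow>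
     (\<exists>h. continuous_on (closure \<Omega>) h \<and> (\<forall>x\<in>\<Omega>. h x = g x))"

definition C2_closure :: "(real ^ 'n) set \<Rightarrow> (real ^ 'n \<Rightarrow> real) \<Rightarrow> bool" where
  "C2_closure \<Omega> u \<longleftrightarrow>
     Ck_on 2 \<Omega> u \<and> continuous_on (closure \<Omega>) u \<and>
     (\<forall>i. extends_to_closure \<Omega> (partial_deriv i u)) \<and>
     (\<forall>i j. extends_to_closure \<Omega> (partial_deriv i (partial_deriv j u)))"

(* For x in the frontier of \<Omega> this is the value at x of the continuous extension of the Hessian;
   the two-sided derivatives at x itself would depend on values of u outside the closure. *)
definition boundary_hessian ::
    "(real ^ 'n) set \<Rightarrow> (real ^ 'n \<Rightarrow> real) \<Rightarrow> real ^ 'n \<Rightarrow> real ^ 'n ^ 'n" where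
  "boundary_hessian \<Omega> u x = Lim (at x within \<Omega>) (hessian u)"

(* \<Omega> need not be convex, so this differs from concave_on. *)
definition concave_in :: "(real ^ 'n) set \<Rightarrow> (real ^ 'n \<Rightarrow> real) \<Rightarrow> bool" where
  "concave_in \<Omega> u \<longleftrightarrow>
     (\<forall>x\<in>\<Omega>. \<forall>\<nu>. norm \<nu> = 1 \<longrightarrow> dir_deriv \<nu> (dir_deriv \<nu> u) x \<le> 0)"

end

(* For a unit vector \<nu> and small h, the second difference
   W x = u (x + h \<nu>) + u (x - h \<nu>) - 2 u x satisfies -\<Delta>W \<le> f'(u) W because f is concave; using W
   instead of the second derivative avoids differentiating the equation, u being only C^2.
   Concavity of f together with f 0 > 0 also makes u + \<delta> a strict supersolution of
   \<Delta> + f'(u), positive up to the boundary, as soon as f'(0) \<delta> < f 0. Hence W / (u + \<delta>) has no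
   positive interior maximum. Near the boundary W \<le> \<eta> h^2 with \<eta> arbitrarily small by the
   hypothesis on the boundary Hessian, and dividing by h^2 shows that no second directional
   derivative of u can be positive. *)
theory Submission
  imports Defs
begin

section \<open>Second differences and second directional derivatives\<close>

definition second_diff :: "('a::real_vector \<Rightarrow> real) \<Rightarrow> 'a \<Rightarrow> 'a \<Rightarrow> real" where
  "second_diff g v x = g (x + v) + g (x - v) - 2 * g x"

text \<open>Subtracting \<open>c * t\<^sup>2 / 2\<close> leaves a function with nonnegative second
  derivative, hence convex on the interval. Midpoint convexity at the two endpoints is the claimed
  bound.\<close>

lemma second_diff_ge_real:
  fixes \<phi> \<phi>' \<phi>'' :: "real \<Rightarrow> real"
  assumes h: "0 \<le> h"
    and d1: "\<And>t. \<bar>t\<bar> \<le> h \<Longrightarrow> (\<phi> has_real_derivative \<phi>' t) (at t)"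
    and d2: "\<And>t. \<bar>t\<bar> \<le> h \<Longrightarrow> (\<phi>' has_real_derivative \<phi>'' t) (at t)"
    and c: "\<And>t. \<bar>t\<bar> \<le> h \<Longrightarrow> c \<le> \<phi>'' t"
  shows "c * h\<^sup>2 \<le> second_diff \<phi> h 0"
proof -
  have "convex_on {-h..h} (\<lambda>t. \<phi> t - c * t\<^sup>2 / 2)"
  proof (rule f''_ge0_imp_convex)
    show "((\<lambda>t. \<phi> t - c * t\<^sup>2 / 2) has_real_derivative \<phi>' t - c * t) (at t)"
      if "t \<in> {-h..h}" for t
      using that by (auto intro!: derivative_eq_intros d1)
    show "((\<lambda>t. \<phi>' t - c * t) has_real_derivative \<phi>'' t - c) (at t)"
      if "t \<in> {-h..h}" for t
      using that by (auto intro!: derivative_eq_intros d2)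
    show "0 \<le> \<phi>'' t - c" if "t \<in> {-h..h}" for t
      using that c[of t] by auto
  qed simp
  from convex_onD[OF this, of "1/2" "-h" h] h show ?thesis
    by (simp add: second_diff_def field_simps)
qed

lemma Ck_on_2D:
  assumes "Ck_on 2 S u"
  shows "x \<in> S \<Longrightarrow> u differentiable (at x)"
    and "x \<in> S \<Longrightarrow> dir_deriv v u differentiable (at x)"
    and "continuous_on S (dir_deriv w (dir_deriv v u))"
  using assms by (auto simp: numeral_2_eq_2)

lemma dir_deriv_along_line:
  assumes "g differentiable (at (x + t *\<^sub>R v))"
  shows "((\<lambda>s. g (x + s *\<^sub>R v)) has_real_derivative dir_deriv v g (x + t *\<^sub>R v)) (at t)"
proof -
  let ?D = "frechet_derivative g (at (x + t *\<^sub>R v))"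
  have D: "(g has_derivative ?D) (at (x + t *\<^sub>R v))"
    using assms frechet_derivative_works by blast
  have "((\<lambda>s. x + s *\<^sub>R v) has_derivative (\<lambda>s. s *\<^sub>R v)) (at t)"
    by (auto intro!: derivative_eq_intros)
  from diff_chain_at[OF this D]
  have "((\<lambda>s. g (x + s *\<^sub>R v)) has_derivative (\<lambda>s. ?D (s *\<^sub>R v))) (at t)"
    by (simp add: o_def)
  moreover have "(\<lambda>s. ?D (s *\<^sub>R v)) = (*) (dir_deriv v g (x + t *\<^sub>R v))"
    using linear_frechet_derivative[OF assms] by (auto simp: dir_deriv_def linear_cmul)
  ultimately show ?thesis
    by (simp add: has_field_derivative_def)
qed

lemma dir_deriv_sum_partial_deriv:
  assumes "g differentiable (at x)"
  shows "dir_deriv v g x = (\<Sum>i\<in>UNIV. v $ i * partial_deriv i g x)"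
proof -
  note lin = linear_frechet_derivative[OF assms]
  have "dir_deriv v g x = frechet_derivative g (at x) (\<Sum>i\<in>UNIV. v $ i *\<^sub>R axis i 1)"
    using basis_expansion[of v] by (simp add: dir_deriv_def scalar_mult_eq_scaleR)
  also have "\<dots> = (\<Sum>i\<in>UNIV. v $ i * partial_deriv i g x)"
    by (simp add: linear_sum[OF lin] linear_cmul[OF lin] partial_deriv_def dir_deriv_def)
  finally show ?thesis .
qed

text \<open>The link between the boundary hypothesis, stated for the Hessian matrix, and concavity,
  stated for second directional derivatives.\<close>

lemma dir_deriv_twice_hessian:
  assumes S: "open S" and u: "Ck_on 2 S u" and x: "x \<in> S"
  shows "dir_deriv v (dir_deriv v u) x = v \<bullet> (hessian u x *v v)"
proof -
  note part = Ck_on_2D(2)[OF u x, of "axis i 1" for i, folded partial_deriv_def]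
  let ?D = "\<lambda>i. frechet_derivative (partial_deriv i u) (at x)"
  have "((\<lambda>y. \<Sum>i\<in>UNIV. v $ i * partial_deriv i u y) has_derivative
         (\<lambda>w. \<Sum>i\<in>UNIV. v $ i * ?D i w)) (at x)"
    using part by (auto intro!: derivative_eq_intros simp: frechet_derivative_works)
  \<comment> \<open>The expansion in partial derivatives holds on all of \<open>S\<close>, and
    \<open>S\<close> is open, so it may be differentiated at \<open>x\<close>.\<close>
  then have "(dir_deriv v u has_derivative (\<lambda>w. \<Sum>i\<in>UNIV. v $ i * ?D i w)) (at x)"
    by (rule has_derivative_transform_within_open[OF _ S x])
       (simp add: dir_deriv_sum_partial_deriv Ck_on_2D(1)[OF u])
  then have "frechet_derivative (dir_deriv v u) (at x) = (\<lambda>w. \<Sum>i\<in>UNIV. v $ i * ?D i w)"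
    by (rule frechet_derivative_at[symmetric])
  then have "dir_deriv v (dir_deriv v u) x = (\<Sum>i\<in>UNIV. v $ i * dir_deriv v (partial_deriv i u) x)"
    by (simp add: dir_deriv_def)
  also have "\<dots> = (\<Sum>i\<in>UNIV. \<Sum>j\<in>UNIV. v $ i * (v $ j * hessian u x $ j $ i))"
    by (simp add: dir_deriv_sum_partial_deriv[OF part] hessian_def sum_distrib_left)
  also have "\<dots> = v \<bullet> (hessian u x *v v)"
    by (subst sum.swap)
       (simp add: inner_vec_def matrix_vector_mult_def sum_distrib_left mult_ac)
  finally show ?thesis .
qed

text \<open>Both bounds come from the one-variable estimate on the line through \<open>x\<close> in
  direction \<open>v\<close>; the upper one applies it to the negated function.\<close>

lemma
  assumes u: "Ck_on 2 S u" and h: "0 \<le> h"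
    and S: "\<And>t. \<bar>t\<bar> \<le> h \<Longrightarrow> x + t *\<^sub>R v \<in> S"
  shows second_diff_ge:
      "(\<And>t. \<bar>t\<bar> \<le> h \<Longrightarrow> c \<le> dir_deriv v (dir_deriv v u) (x + t *\<^sub>R v)) \<Longrightarrow>
        c * h\<^sup>2 \<le> second_diff u (h *\<^sub>R v) x"
    and second_diff_le:
      "(\<And>t. \<bar>t\<bar> \<le> h \<Longrightarrow> dir_deriv v (dir_deriv v u) (x + t *\<^sub>R v) \<le> c) \<Longrightarrow>
        second_diff u (h *\<^sub>R v) x \<le> c * h\<^sup>2"
proof -
  note d = dir_deriv_along_line[OF Ck_on_2D(1)[OF u S]]
    dir_deriv_along_line[OF Ck_on_2D(2)[OF u S]]
  show "c * h\<^sup>2 \<le> second_diff u (h *\<^sub>R v) x"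
    if "\<And>t. \<bar>t\<bar> \<le> h \<Longrightarrow> c \<le> dir_deriv v (dir_deriv v u) (x + t *\<^sub>R v)"
    using second_diff_ge_real[OF h d that] by (simp add: second_diff_def)
  show "second_diff u (h *\<^sub>R v) x \<le> c * h\<^sup>2"
    if "\<And>t. \<bar>t\<bar> \<le> h \<Longrightarrow> dir_deriv v (dir_deriv v u) (x + t *\<^sub>R v) \<le> c"
    using second_diff_ge_real[OF h DERIV_minus[OF d(1)] DERIV_minus[OF d(2)], where c = "- c"] that
    by (simp add: second_diff_def)
qed

text \<open>By continuity the second derivative stays within \<open>e / 2\<close> of its value at
  \<open>x\<close> on a short segment, and the two bounds above squeeze the quotient. Half of
  \<open>e\<close> turns these weak bounds into a strict one.\<close>

lemma tendsto_second_diff: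
  assumes S: "open S" and u: "Ck_on 2 S u" and x: "x \<in> S"
  shows "((\<lambda>t. second_diff u (t *\<^sub>R v) x / t\<^sup>2) \<longlongrightarrow> dir_deriv v (dir_deriv v u) x) (at_right 0)"
proof (rule tendstoI)
  fix e :: real assume e: "0 < e"
  let ?D = "dir_deriv v (dir_deriv v u)"
  have "isCont ?D x"
    using Ck_on_2D(3)[OF u] S x by (simp add: continuous_on_eq_continuous_at)
  moreover have "((\<lambda>t. x + t *\<^sub>R v) \<longlongrightarrow> x + 0 *\<^sub>R v) (at (0::real))"
    by (intro tendsto_intros)
  ultimately have "((\<lambda>t. ?D (x + t *\<^sub>R v)) \<longlongrightarrow> ?D x) (at (0::real))"
    using isCont_tendsto_compose by fastforce
  moreover have "\<forall>\<^sub>F t in at (0::real). x + t *\<^sub>R v \<in> S"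
    using topological_tendstoD[OF \<open>(_ \<longlongrightarrow> x + 0 *\<^sub>R v) _\<close> S] x by simp
  ultimately have "\<forall>\<^sub>F t in at (0::real). x + t *\<^sub>R v \<in> S \<and> dist (?D (x + t *\<^sub>R v)) (?D x) < e / 2"
    using tendstoD[of _ _ _ "e / 2"] e by (intro eventually_conj) simp_all
  then obtain r where r: "r > 0"
    "\<And>t. t \<noteq> 0 \<Longrightarrow> \<bar>t\<bar> < r \<Longrightarrow> x + t *\<^sub>R v \<in> S \<and> dist (?D (x + t *\<^sub>R v)) (?D x) < e / 2"
    by (auto simp: eventually_at)
  \<comment> \<open>The punctured filter says nothing about \<open>t = 0\<close>, but the bounds on
    a whole segment need that point too.\<close>
  have r': "x + t *\<^sub>R v \<in> S" "?D x - e / 2 \<le> ?D (x + t *\<^sub>R v)" "?D (x + t *\<^sub>R v) \<le> ?D x + e / 2"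
    if "\<bar>t\<bar> < r" for t
  proof -
    have "x + t *\<^sub>R v \<in> S \<and> dist (?D (x + t *\<^sub>R v)) (?D x) < e / 2"
      using r(2)[of t] that x e by (cases "t = 0") simp_all
    then show "x + t *\<^sub>R v \<in> S" "?D x - e / 2 \<le> ?D (x + t *\<^sub>R v)"
      "?D (x + t *\<^sub>R v) \<le> ?D x + e / 2"
      unfolding dist_real_def by linarith+
  qed
  have "dist (second_diff u (t *\<^sub>R v) x / t\<^sup>2) (?D x) < e" if t: "0 < t" "t < r" for t
  proof -
    have "(?D x - e / 2) * t\<^sup>2 \<le> second_diff u (t *\<^sub>R v) x"
      by (rule second_diff_ge[OF u]) (use t r' in auto)
    moreover have "second_diff u (t *\<^sub>R v) x \<le> (?D x + e / 2) * t\<^sup>2"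
      by (rule second_diff_le[OF u]) (use t r' in auto)
    ultimately have "?D x - e / 2 \<le> second_diff u (t *\<^sub>R v) x / t\<^sup>2"
      "second_diff u (t *\<^sub>R v) x / t\<^sup>2 \<le> ?D x + e / 2"
      using t by (auto simp: divide_le_eq le_divide_eq)
    then show ?thesis
      using e by (simp add: dist_real_def abs_if)
  qed
  then show "\<forall>\<^sub>F t in at_right 0. dist (second_diff u (t *\<^sub>R v) x / t\<^sup>2) (?D x) < e"
    using r(1) by (auto simp: eventually_at_right_field)
qed

section \<open>Concave functions on the half-line\<close>

lemma has_real_derivative_nonpos_imp_antimono:
  fixes g g' :: "real \<Rightarrow> real"
  assumes g: "\<And>t. t \<ge> 0 \<Longrightarrow> (g has_real_derivative g' t) (at t within {0..})"
    and le: "\<And>t. t \<ge> 0 \<Longrightarrow> g' t \<le> 0" and ab: "0 \<le> a" "a \<le> b"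
  shows "g b \<le> g a"
proof -
  have "\<exists>x\<in>{a..b}. g b - g a = g' x * (b - a)"
    by (rule mvt_very_simple)
       (use ab in \<open>auto intro!: has_derivative_subset[OF g[unfolded has_field_derivative_def]]\<close>)
  then show ?thesis
    using le ab by (smt (verit) atLeastAtMost_iff mult_nonpos_nonneg)
qed

text \<open>The mean value theorem gives a slope \<open>f' x\<close> at a point between
  \<open>a\<close> and \<open>c\<close>; since \<open>f'\<close> is decreasing, it compares with
  \<open>f' c\<close> in the right direction on either side of \<open>c\<close>.\<close>

lemma concave_below_tangent:
  fixes f f' f'' :: "real \<Rightarrow> real"
  assumes f: "\<And>t. t \<ge> 0 \<Longrightarrow> (f has_real_derivative f' t) (at t within {0..})"
    and f': "\<And>t. t \<ge> 0 \<Longrightarrow> (f' has_real_derivative f'' t) (at t within {0..})"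
    and f'': "\<And>t. t \<ge> 0 \<Longrightarrow> f'' t \<le> 0"
    and ac: "0 \<le> a" "0 \<le> c"
  shows "f a \<le> f c + f' c * (a - c)"
proof (cases "c \<le> a")
  case True
  have "\<exists>x\<in>{c..a}. f a - f c = f' x * (a - c)"
    by (rule mvt_very_simple)
       (use ac True in \<open>auto intro!: has_derivative_subset[OF f[unfolded has_field_derivative_def]]\<close>)
  then obtain x where x: "c \<le> x" "f a - f c = f' x * (a - c)"
    by auto
  have "f' x \<le> f' c"
    using has_real_derivative_nonpos_imp_antimono[OF f' f'' ac(2) x(1)] .
  then have "f' x * (a - c) \<le> f' c * (a - c)"
    using True by (simp add: mult_right_mono)
  with x show ?thesis by simp
next
  case False
  have "\<exists>x\<in>{a..c}. f c - f a = f' x * (c - a)"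
    by (rule mvt_very_simple)
       (use ac False in \<open>auto intro!: has_derivative_subset[OF f[unfolded has_field_derivative_def]]\<close>)
  then obtain x where x: "a \<le> x" "x \<le> c" "f c - f a = f' x * (c - a)"
    by auto
  have "f' c \<le> f' x"
    using has_real_derivative_nonpos_imp_antimono[OF f' f'' order_trans[OF ac(1) x(1)] x(2)] .
  then have "f' c * (c - a) \<le> f' x * (c - a)"
    using False by (simp add: mult_right_mono)
  with x show ?thesis by (simp add: algebra_simps)
qed

section \<open>Points near the boundary\<close>

lemma add_mem_if_infdist_frontier:
  fixes S :: "'a::real_normed_vector set"
  assumes "x \<in> S" "norm v < infdist x (frontier S)"
  shows "x + v \<in> S"
proof (rule ccontr)
  assume "x + v \<notin> S"
  moreover have "x + v \<in> cball x (norm v)" "x \<in> cball x (norm v)"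
    by (auto simp: dist_norm)
  \<comment> \<open>A ball is connected, so meeting both \<open>S\<close> and its complement forces
    it to meet the frontier.\<close>
  ultimately obtain y where y: "y \<in> cball x (norm v)" "y \<in> frontier S"
    using connected_Int_frontier[OF connected_cball, of x "norm v" S] assms(1) by blast
  then have "infdist x (frontier S) \<le> norm v"
    using infdist_le2[of y "frontier S" x "norm v"] by simp
  with assms(2) show False by simp
qed

text \<open>A frontier point of an open set lies outside the set and is a limit point of it. The
  filter is therefore nontrivial, and \<open>Lim\<close> picks the unique limit, which is the value
  of the extension.\<close>

lemma boundary_hessian_eq:
  assumes S: "open S" and x: "x \<in> frontier S"
    and ext: "continuous_on (closure S) H" "\<And>y. y \<in> S \<Longrightarrow> H y = hessian u y"
  shows "boundary_hessian S u x = H x"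
  unfolding boundary_hessian_def
proof (rule tendsto_Lim)
  have "x \<in> closure S" "x \<notin> S"
    using S x by (auto simp: frontier_def interior_open)
  then show "\<not> trivial_limit (at x within S)"
    by (metis trivial_limit_within closure_def UnE mem_Collect_eq)
  have "(H \<longlongrightarrow> H x) (at x within S)"
    using ext(1) \<open>x \<in> closure S\<close> closure_subset
    by (auto simp: continuous_on_def intro: tendsto_within_subset)
  then show "(hessian u \<longlongrightarrow> H x) (at x within S)"
    by (rule Lim_transform_eventually) (use ext(2) in \<open>auto simp: eventually_at_filter\<close>)
qed

text \<open>The quadratic form of the extended Hessian is uniformly continuous on the compact
  closure and nonpositive on the frontier. Comparing a point with its nearest frontier point gives a
  \<rho> that works uniformly.\<close>

lemma dir_deriv_twice_near_frontier:
  assumes S: "open S" "bounded S" and u: "C2_closure S u"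
    and neg: "\<And>x. x \<in> frontier S \<Longrightarrow> neg_semidefinite (boundary_hessian S u x)"
    and e: "0 < \<eta>"
  obtains \<rho> where "0 < \<rho>"
    "\<And>x. x \<in> S \<Longrightarrow> infdist x (frontier S) < \<rho> \<Longrightarrow> dir_deriv v (dir_deriv v u) x \<le> \<eta>"
proof -
  have Ck: "Ck_on 2 S u"
    using u by (simp add: C2_closure_def)
  have "\<forall>i j. \<exists>h. continuous_on (closure S) h \<and> (\<forall>x\<in>S. h x = partial_deriv i (partial_deriv j u) x)"
    using u by (auto simp: C2_closure_def extends_to_closure_def)
  then obtain h where h: "\<And>i j. continuous_on (closure S) (h i j)"
    "\<And>i j x. x \<in> S \<Longrightarrow> h i j x = partial_deriv i (partial_deriv j u) x"
    by metis
  define H where "H x = (\<chi> i j. h i j x)" for x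
  have H: "continuous_on (closure S) H" "\<And>x. x \<in> S \<Longrightarrow> H x = hessian u x"
    unfolding H_def by (auto intro!: continuous_intros h simp: hessian_def h vec_eq_iff)
  define q where "q x = v \<bullet> (H x *v v)" for x
  have "continuous_on (closure S) q"
    unfolding q_def matrix_vector_mult_def H_def by (auto intro!: continuous_intros h)
  then have "uniformly_continuous_on (closure S) q"
    using S by (simp add: compact_uniformly_continuous)
  then obtain \<rho> where \<rho>: "0 < \<rho>"
    "\<And>x y. x \<in> closure S \<Longrightarrow> y \<in> closure S \<Longrightarrow> dist y x < \<rho> \<Longrightarrow> dist (q y) (q x) < \<eta>"
    using e unfolding uniformly_continuous_on_def by meson
  have "dir_deriv v (dir_deriv v u) x \<le> \<eta>" if x: "x \<in> S" "infdist x (frontier S) < \<rho>" for x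
  proof -
    \<comment> \<open>A nonempty frontier is required for the distance to it to be attained.\<close>
    have "S \<noteq> UNIV"
      using S(2) not_bounded_UNIV by auto
    then have "frontier S \<noteq> {}"
      using x frontier_not_empty by auto
    then obtain p where p: "p \<in> frontier S" "infdist x (frontier S) = dist x p"
      using infdist_attains_inf[OF frontier_closed, of S x] by auto
    have "dist (q x) (q p) < \<eta>"
      using \<rho>(2)[of p x] p x closure_subset by (auto simp: frontier_def)
    moreover have "q p \<le> 0"
      using neg[OF p(1)] by (simp add: boundary_hessian_eq[OF S(1) p(1) H] q_def neg_semidefinite_def)
    ultimately show ?thesis
      using x by (simp add: dir_deriv_twice_hessian[OF S(1) Ck] q_def H(2) dist_real_def)
  qed
  with \<rho>(1) that show ?thesis by blast
qed

section \<open>The touching argument at a maximum\<close>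

text \<open>The difference \<open>second_diff u w y - m * (u y + d)\<close> has a local maximum in
  \<open>y\<close> at \<open>x\<close>, so its second differences there in small coordinate steps
  are nonpositive. Dividing by \<open>t\<^sup>2\<close>, passing to the limit and summing over
  coordinates gives the Laplacian without differentiating \<open>u\<close> more than twice.\<close>

lemma laplacian_second_diff_le:
  assumes S: "open S" and u: "Ck_on 2 S u" and x: "x \<in> S" "x + w \<in> S" "x - w \<in> S"
    and le: "\<forall>\<^sub>F y in nhds x. second_diff u w y \<le> m * (u y + d)"
    and eq: "second_diff u w x = m * (u x + d)"
  shows "second_diff (laplacian u) w x \<le> m * laplacian u x"
proof -
  define D where "D i = partial_deriv i (partial_deriv i u)" for i
  have "second_diff (D i) w x \<le> m * D i x" for i
  proof (rule tendsto_le)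
    let ?e = "axis i 1"
    let ?q = "\<lambda>y t. second_diff u (t *\<^sub>R ?e) y / t\<^sup>2"
    have lim: "((\<lambda>t. ?q y t) \<longlongrightarrow> D i y) (at_right 0)" if "y \<in> S" for y
      using tendsto_second_diff[OF S u that, of ?e] by (simp add: D_def partial_deriv_def)
    show "((\<lambda>t. m * ?q x t) \<longlongrightarrow> m * D i x) (at_right 0)"
      by (rule tendsto_mult_left[OF lim[OF x(1)]])
    show "((\<lambda>t. ?q (x + w) t + ?q (x - w) t - 2 * ?q x t) \<longlongrightarrow> second_diff (D i) w x) (at_right 0)"
      unfolding second_diff_def[of "D i"]
      by (rule tendsto_diff[OF tendsto_add[OF lim[OF x(2)] lim[OF x(3)]]
            tendsto_mult_left[OF lim[OF x(1)]]])
    have "((\<lambda>t. x + t *\<^sub>R ?e) \<longlongrightarrow> x + 0 *\<^sub>R ?e) (at_right (0::real))"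
      "((\<lambda>t. x - t *\<^sub>R ?e) \<longlongrightarrow> x - 0 *\<^sub>R ?e) (at_right (0::real))"
      by (intro tendsto_intros)+
    then have "((\<lambda>t. x + t *\<^sub>R ?e) \<longlongrightarrow> x) (at_right (0::real))"
      "((\<lambda>t. x - t *\<^sub>R ?e) \<longlongrightarrow> x) (at_right (0::real))"
      by simp_all
    note ev = this[THEN eventually_compose_filterlim[OF le]]
    show "\<forall>\<^sub>F t in at_right 0. ?q (x + w) t + ?q (x - w) t - 2 * ?q x t \<le> m * ?q x t"
      using ev(1) ev(2) eventually_at_right_less[of 0]
    proof eventually_elim
      case (elim t)
      let ?y = "x + t *\<^sub>R ?e" and ?z = "x - t *\<^sub>R ?e"
      have "second_diff u w ?y + second_diff u w ?z - 2 * second_diff u w x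
          \<le> m * (u ?y + d) + m * (u ?z + d) - 2 * (m * (u x + d))"
        using elim(1,2) eq by simp
      \<comment> \<open>Second differences in the directions \<open>w\<close> and
        \<open>t *\<^sub>R ?e\<close> commute, and the constant \<open>d\<close> cancels.\<close>
      then have "second_diff u (t *\<^sub>R ?e) (x + w) + second_diff u (t *\<^sub>R ?e) (x - w)
          - 2 * second_diff u (t *\<^sub>R ?e) x \<le> m * second_diff u (t *\<^sub>R ?e) x"
        by (simp add: second_diff_def algebra_simps)
      then have "(second_diff u (t *\<^sub>R ?e) (x + w) + second_diff u (t *\<^sub>R ?e) (x - w)
          - 2 * second_diff u (t *\<^sub>R ?e) x) / t\<^sup>2 \<le> m * second_diff u (t *\<^sub>R ?e) x / t\<^sup>2"
        by (rule divide_right_mono) simp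
      then show ?case
        by (simp add: add_divide_distrib diff_divide_distrib)
    qed
  qed simp
  then have "(\<Sum>i\<in>UNIV. second_diff (D i) w x) \<le> (\<Sum>i\<in>UNIV. m * D i x)"
    by (intro sum_mono)
  then show ?thesis
    by (simp add: second_diff_def laplacian_def D_def sum.distrib sum_subtractf sum_distrib_left)
qed

section \<open>Comparison with the supersolution \<open>u + \<delta>\<close>\<close>

theorem theorem1:
  fixes \<Omega> :: "(real ^ 'n) set"
    and f f' f'' :: "real \<Rightarrow> real"
    and u :: "real ^ 'n \<Rightarrow> real"
  assumes "open \<Omega>" "connected \<Omega>" "\<Omega> \<noteq> {}" "bounded \<Omega>" "smooth_boundary \<Omega>"
    and "\<And>t. t \<ge> 0 \<Longrightarrow> (f has_real_derivative f' t) (at t within {0..})"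
    and "\<And>t. t \<ge> 0 \<Longrightarrow> (f' has_real_derivative f'' t) (at t within {0..})"
    and "continuous_on {0..} f''"
    and "\<And>t. t \<ge> 0 \<Longrightarrow> f t > 0"
    and "\<And>t. t \<ge> 0 \<Longrightarrow> f' t \<ge> 0"
    and "\<And>t. t \<ge> 0 \<Longrightarrow> f'' t \<le> 0"
    and "f' 0 \<le> 2 * real CARD('n) * measure lebesgue (ball (0 :: real ^ 'n) 1) powr (2 / real CARD('n))
                 / measure lebesgue \<Omega> powr (2 / real CARD('n))"
    and "C2_closure \<Omega> u"
    and "\<And>x. x \<in> closure \<Omega> \<Longrightarrow> u x \<ge> 0"
    and "\<And>x. x \<in> \<Omega> \<Longrightarrow> - laplacian u x = f (u x)"
    and "\<And>x. x \<in> frontier \<Omega> \<Longrightarrow> u x = 0"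
    and "\<And>x. x \<in> frontier \<Omega> \<Longrightarrow> neg_semidefinite (boundary_hessian \<Omega> u x)"
  shows "concave_in \<Omega> u"
  unfolding concave_in_def
proof (intro ballI allI impI)
  fix x0 \<nu> :: "real ^ 'n"
  assume x0: "x0 \<in> \<Omega>" and \<nu>: "norm \<nu> = 1"
  note f = assms(6) and f' = assms(7) and f_pos = assms(9) and f'_nonneg = assms(10)
    and f''_nonpos = assms(11) and u_nonneg = assms(14) and eqn = assms(15)
  have Ck: "Ck_on 2 \<Omega> u" and cont_u: "continuous_on (closure \<Omega>) u"
    using assms(13) by (auto simp: C2_closure_def)
  have uO: "0 \<le> u x" if "x \<in> \<Omega>" for x
    using u_nonneg that closure_subset by blast
  let ?D = "dir_deriv \<nu> (dir_deriv \<nu> u)" and ?F = "frontier \<Omega>"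
  \<comment> \<open>The summand 1 keeps the denominator positive when \<open>f' 0 = 0\<close> and
    makes \<open>f' 0 * \<delta> < f 0\<close> strict.\<close>
  define \<delta> where "\<delta> = f 0 / (f' 0 + 1)"
  have \<delta>: "0 < \<delta>" "f' 0 * \<delta> < f 0"
    using f_pos[of 0] f'_nonneg[of 0] by (auto simp: \<delta>_def field_simps)
  have supersol: "f' s * (s + \<delta>) < f s" if "0 \<le> s" for s
  proof -
    have "f' s * \<delta> \<le> f' 0 * \<delta>"
      using has_real_derivative_nonpos_imp_antimono[OF f' f''_nonpos order_refl that] \<delta>(1)
      by (simp add: mult_right_mono)
    \<comment> \<open>The tangent to \<open>f\<close> at \<open>s\<close>, evaluated at 0.\<close>
    moreover have "f 0 \<le> f s + f' s * (0 - s)"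
      by (rule concave_below_tangent[OF f f' f''_nonpos]) (use that in auto)
    ultimately show ?thesis
      using \<delta>(2) by (simp add: algebra_simps)
  qed
  show "?D x0 \<le> 0"
  proof (rule ccontr)
    assume "\<not> ?D x0 \<le> 0"
    define c where "c = ?D x0 / 2"
    with \<open>\<not> ?D x0 \<le> 0\<close> have c: "0 < c" "c < ?D x0"
      by auto
    \<comment> \<open>Half of the value \<open>c * \<delta> / (u x0 + \<delta>)\<close> that a
      maximum near the boundary would force \<open>W / h\<^sup>2\<close> to exceed.\<close>
    define \<eta> where "\<eta> = c * \<delta> / (2 * (u x0 + \<delta>))"
    have \<phi>0: "0 < u x0 + \<delta>"
      using uO[OF x0] \<delta> by simp
    then have \<eta>: "0 < \<eta>"
      using c \<delta> by (simp add: \<eta>_def)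
    obtain \<rho> where \<rho>: "0 < \<rho>" "\<And>x. x \<in> \<Omega> \<Longrightarrow> infdist x ?F < \<rho> \<Longrightarrow> ?D x \<le> \<eta>"
      using dir_deriv_twice_near_frontier[OF assms(1,4,13,17) \<eta>, of \<nu>] by blast
    have "\<Omega> \<noteq> UNIV"
      using assms(4) not_bounded_UNIV by auto
    then have F: "?F \<noteq> {}"
      using x0 frontier_not_empty by auto
    have "x0 \<notin> ?F"
      using x0 assms(1) by (simp add: frontier_def interior_open)
    then have dist0: "0 < infdist x0 ?F"
      using F by (simp add: infdist_pos_not_in_closed)
    have "\<forall>\<^sub>F h in at_right 0. c < second_diff u (h *\<^sub>R \<nu>) x0 / h\<^sup>2"
      using tendsto_second_diff[OF assms(1) Ck x0] c(2) by (rule order_tendstoD)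
    \<comment> \<open>The first bound puts \<open>x0\<close> into the set \<open>K\<close> below.
      The second keeps segments of half-length \<open>h\<close> around points at distance at most
      \<open>2 * h\<close> from the frontier inside the \<rho>-strip.\<close>
    moreover have "\<forall>\<^sub>F h in at_right 0. h \<in> {0<..<min (infdist x0 ?F / 2) (\<rho> / 3)}"
      by (rule eventually_at_right_real) (use dist0 \<rho> in simp)
    ultimately have "\<forall>\<^sub>F h in at_right 0. c < second_diff u (h *\<^sub>R \<nu>) x0 / h\<^sup>2
        \<and> h \<in> {0<..<min (infdist x0 ?F / 2) (\<rho> / 3)}"
      by (rule eventually_conj)
    then obtain h where "c < second_diff u (h *\<^sub>R \<nu>) x0 / h\<^sup>2
        \<and> h \<in> {0<..<min (infdist x0 ?F / 2) (\<rho> / 3)}"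
      using eventually_happens'[OF trivial_limit_at_right_real] by blast
    then have h: "0 < h" "2 * h < infdist x0 ?F" "3 * h < \<rho>"
      and "c < second_diff u (h *\<^sub>R \<nu>) x0 / h\<^sup>2"
      by auto
    then have h0: "c * h\<^sup>2 < second_diff u (h *\<^sub>R \<nu>) x0"
      by (simp add: less_divide_eq)
    \<comment> \<open>The margin \<open>2 * h\<close> exceeds the step \<open>h\<close>, so
      translates of points of \<open>K\<close> stay in \<Omega>, while compactness of
      \<open>K\<close> provides a maximum of the quotient.\<close>
    define K where "K = closure \<Omega> \<inter> {x. 2 * h \<le> infdist x ?F}"
    have "compact K"
      unfolding K_def
      by (intro compact_Int_closed closed_Collect_le continuous_intros) (use assms(4) in simp)
    have K: "x \<in> \<Omega>" "x + t *\<^sub>R \<nu> \<in> \<Omega>" if "x \<in> K" "\<bar>t\<bar> \<le> h" for x t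
    proof -
      have "x \<notin> ?F"
        using that h by (auto simp: K_def)
      then show "x \<in> \<Omega>"
        using that interior_subset by (auto simp: K_def frontier_def)
      then show "x + t *\<^sub>R \<nu> \<in> \<Omega>"
        by (rule add_mem_if_infdist_frontier) (use that h \<nu> in \<open>auto simp: K_def\<close>)
    qed
    have Kpm: "x + h *\<^sub>R \<nu> \<in> \<Omega>" "x - h *\<^sub>R \<nu> \<in> \<Omega>" if "x \<in> K" for x
      using K(2)[OF that, of h] K(2)[OF that, of "-h"] h by auto
    have "x0 \<in> K"
      using x0 h closure_subset by (auto simp: K_def)
    define W where "W = second_diff u (h *\<^sub>R \<nu>)"
    have "continuous_on K u"
      by (rule continuous_on_subset[OF cont_u]) (simp add: K_def)
    moreover have "continuous_on K (\<lambda>x. u (x + h *\<^sub>R \<nu>))" "continuous_on K (\<lambda>x. u (x - h *\<^sub>R \<nu>))"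
      using Kpm closure_subset by (auto intro!: continuous_on_compose2[OF cont_u] continuous_intros)
    moreover have \<phi>K: "0 < u x + \<delta>" if "x \<in> K" for x
      using uO[OF K(1)[OF that, of 0]] h \<delta> by auto
    ultimately have "continuous_on K (\<lambda>x. W x / (u x + \<delta>))"
      unfolding W_def second_diff_def by (intro continuous_intros) force+
    then obtain x1 where x1: "x1 \<in> K" "\<And>x. x \<in> K \<Longrightarrow> W x / (u x + \<delta>) \<le> W x1 / (u x1 + \<delta>)"
      using continuous_attains_sup[OF \<open>compact K\<close>] \<open>x0 \<in> K\<close> by blast
    define m where "m = W x1 / (u x1 + \<delta>)"
    have W_le: "W x \<le> m * (u x + \<delta>)" if "x \<in> K" for x
      using x1(2)[OF that] \<phi>K[OF that] by (simp add: m_def divide_le_eq)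
    have W_eq: "W x1 = m * (u x1 + \<delta>)"
      using \<phi>K[OF x1(1)] by (simp add: m_def)
    have m_gt: "c * h\<^sup>2 / (u x0 + \<delta>) < m"
      using h0 W_le[OF \<open>x0 \<in> K\<close>] \<phi>0 by (simp add: W_def divide_less_eq)
    then have m: "0 < m"
      using c h \<phi>0 by (smt (verit) divide_pos_pos mult_pos_pos zero_less_power)
    have x1O: "x1 \<in> \<Omega>"
      using K(1)[OF x1(1), of 0] h by simp
    have ux1: "0 \<le> u x1"
      using uO[OF x1O] .
    show False
    proof (cases "2 * h < infdist x1 ?F")
      case True
      \<comment> \<open>Here a whole neighbourhood of \<open>x1\<close> lies in \<open>K\<close>, so
        \<open>m * (u + \<delta>)\<close> touches \<open>W\<close> from above at
        \<open>x1\<close>.\<close>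
      have "open (\<Omega> \<inter> {x. 2 * h < infdist x ?F})"
        by (intro open_Int assms(1) open_Collect_less continuous_intros)
      then have "\<forall>\<^sub>F y in nhds x1. y \<in> \<Omega> \<inter> {x. 2 * h < infdist x ?F}"
        by (rule eventually_nhds_in_open) (use x1O True in simp)
      then have "\<forall>\<^sub>F y in nhds x1. W y \<le> m * (u y + \<delta>)"
        by (rule eventually_mono) (use closure_subset[of \<Omega>] in \<open>auto intro!: W_le simp: K_def\<close>)
      then have "second_diff (laplacian u) (h *\<^sub>R \<nu>) x1 \<le> m * laplacian u x1"
        using laplacian_second_diff_le[OF assms(1) Ck x1O Kpm[OF x1(1)], folded W_def] W_eq by blast
      then have "m * f (u x1) \<le> f (u (x1 + h *\<^sub>R \<nu>)) + f (u (x1 - h *\<^sub>R \<nu>)) - 2 * f (u x1)"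
        using x1O Kpm[OF x1(1)] by (simp add: second_diff_def algebra_simps flip: eqn)
      \<comment> \<open>Add the tangent inequalities at \<open>u x1\<close> for the values of
        \<open>u\<close> at the two translates.\<close>
      also have "\<dots> \<le> f' (u x1) * W x1"
        using concave_below_tangent[OF f f' f''_nonpos uO[OF Kpm(1)[OF x1(1)]] ux1]
          concave_below_tangent[OF f f' f''_nonpos uO[OF Kpm(2)[OF x1(1)]] ux1]
        by (simp add: W_def second_diff_def algebra_simps)
      also have "\<dots> = m * (f' (u x1) * (u x1 + \<delta>))"
        by (simp add: W_eq)
      also have "\<dots> < m * f (u x1)"
        using supersol[OF ux1] m by simp
      finally show False by simp
    next
      case False
      \<comment> \<open>Now \<open>x1\<close> is within \<open>2 * h\<close> of the frontier, so the
        segment lies in the \<rho>-strip.\<close>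
      have "?D (x1 + t *\<^sub>R \<nu>) \<le> \<eta>" if t: "\<bar>t\<bar> \<le> h" for t
      proof (rule \<rho>(2)[OF K(2)[OF x1(1) t]])
        have "infdist (x1 + t *\<^sub>R \<nu>) ?F \<le> infdist x1 ?F + dist (x1 + t *\<^sub>R \<nu>) x1"
          by (rule infdist_triangle)
        then show "infdist (x1 + t *\<^sub>R \<nu>) ?F < \<rho>"
          using False t h(3) \<nu> by (simp add: dist_norm)
      qed
      then have "W x1 \<le> \<eta> * h\<^sup>2"
        unfolding W_def using second_diff_le[OF Ck _ K(2)[OF x1(1)]] h by simp
      moreover have "m * \<delta> \<le> W x1"
        unfolding W_eq using m ux1 by simp
      moreover have "c * h\<^sup>2 / (u x0 + \<delta>) * \<delta> < m * \<delta>"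
        using m_gt \<delta>(1) by (rule mult_strict_right_mono)
      \<comment> \<open>By the choice of \<eta>, \<open>m * \<delta>\<close> exceeds
        \<open>2 * (\<eta> * h\<^sup>2)\<close>, whereas \<open>W x1\<close> is at least the former
        and at most half the latter.\<close>
      moreover have "c * h\<^sup>2 / (u x0 + \<delta>) * \<delta> = 2 * (\<eta> * h\<^sup>2)"
        using \<phi>0 by (simp add: \<eta>_def field_simps)
      moreover have "0 < \<eta> * h\<^sup>2"
        using \<eta> h by simp
      ultimately show False by linarith
    qed
  qed
qed

end
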